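(* Let $x[0]$ be a random vector in $\mathbb{R}^n$ that has a probability density function and whose distribution $\mu$ (a Borel measure on $\mathbb{R}^n$) satisfies $\mu(V)>0$ for every non-empty open set $V\subset\mathbb{R}^n$. Suppose that the physical connectivity graph $G_{ph}$ is not a complete graph. Then the expected termination time of the social Hegselmann-Krause dynamics is infinite, i.e., $\mathbb{E}_{x[0]}[T(G_{ph},x[0])]=\infty$.
   Context: Social Hegselmann-Krause (HK) dynamics: there are $n$ agents, with $[n]=\{1,\dots,n\}$, and a fixed confidence bound $R>0$. The physical connectivity graph $G_{ph}=([n],E_{ph})$ is an undirected, time-invariant, connected graph containing all self-loops; it is complete if every pair of vertices is adjacent. The state at time $k=0,1,2,\dots$ is $x[k]\in\mathbb{R}^n$. The influence graph $\tilde G[k]$ has vertex set $[n]$ and has the edge $(i,j)$ iff $(i,j)\in E_{ph}$ and $|x_i[k]-x_j[k]|\le R$. The update rule is $x_i[k+1]=\frac{1}{|\mathcal N_i[k]|}\sum_{j\in\mathcal N_i[k]}x_j[k]$, where $\mathcal N_i[k]$ is the set of neighbors of $i$ in $\tilde G[k]$ (including $i$ itself). For every initial state $x[0]=x_0$ the limit $x_\infty(x_0):=\lim_{k\to\infty}x[k]$ exists and is called the steady state. The termination time is $T(G_{ph},x_0):=\inf\{k\in\mathbb{N}: x[k]=x_\infty(x_0)\}$ (with $\inf\emptyset=\infty$), where $\mathbb{N}$ is the set of positive integers. *)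

theory Defs
  imports "HOL-Probability.Probability"
begin

text \<open>The agents are the elements of a finite type \<open>'n\<close>; graphs on the agents are edge sets.\<close>

definition physical_graph :: "('n \<times> 'n) set \<Rightarrow> bool" where
  "physical_graph E \<longleftrightarrow> sym E \<and> refl E \<and> (\<forall>i j. (i, j) \<in> E\<^sup>*)"

definition is_complete :: "('n \<times> 'n) set \<Rightarrow> bool" where
  "is_complete E \<longleftrightarrow> (\<forall>i j. (i, j) \<in> E)"

definition influence_graph ::
    "('n::finite \<times> 'n) set \<Rightarrow> real \<Rightarrow> real ^ 'n \<Rightarrow> ('n \<times> 'n) set" where
  "influence_graph E R x = {(i, j). (i, j) \<in> E \<and> \<bar>x $ i - x $ j\<bar> \<le> R}"

definition hk_neighbors ::
    "('n::finite \<times> 'n) set \<Rightarrow> real \<Rightarrow> real ^ 'n \<Rightarrow> 'n \<Rightarrow> 'n set" where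
  "hk_neighbors E R x i = {j. (i, j) \<in> influence_graph E R x}"

definition hk_step ::
    "('n::finite \<times> 'n) set \<Rightarrow> real \<Rightarrow> real ^ 'n \<Rightarrow> real ^ 'n" where
  "hk_step E R x =
     (\<chi> i. (1 / real (card (hk_neighbors E R x i))) * (\<Sum>j\<in>hk_neighbors E R x i. x $ j))"

primrec hk_state ::
    "('n::finite \<times> 'n) set \<Rightarrow> real \<Rightarrow> real ^ 'n \<Rightarrow> nat \<Rightarrow> real ^ 'n" where
  "hk_state E R x0 0 = x0"
| "hk_state E R x0 (Suc k) = hk_step E R (hk_state E R x0 k)"

text \<open>The trajectory converges from every initial state when \<open>E\<close> is a physical graph and
  \<open>R > 0\<close>, so \<^const>\<open>lim\<close> is then the actual limit.\<close>

definition steady_state ::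
    "('n::finite \<times> 'n) set \<Rightarrow> real \<Rightarrow> real ^ 'n \<Rightarrow> real ^ 'n" where
  "steady_state E R x0 = lim (hk_state E R x0)"

text \<open>The infimum is over positive times only; in \<^typ>\<open>enat\<close> the infimum of the
  empty set is \<open>\<infinity>\<close>.\<close>

definition termination_time ::
    "('n::finite \<times> 'n) set \<Rightarrow> real \<Rightarrow> real ^ 'n \<Rightarrow> enat" where
  "termination_time E R x0 =
     Inf {enat k | k. 1 \<le> k \<and> hk_state E R x0 k = steady_state E R x0}"

text \<open>Measurability of the termination time, so that its \<open>nn_integral\<close> is
  its expectation.\<close>

lemma measurable_hk_step [measurable]: "hk_step E R \<in> borel_measurable borel"
proof -
  have eq: "hk_step E R = (\<lambda>x. \<chi> i.
      (1 / (\<Sum>j\<in>UNIV. if (i, j) \<in> E \<and> \<bar>x $ i - x $ j\<bar> \<le> R then 1 else 0)) *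
      (\<Sum>j\<in>UNIV. if (i, j) \<in> E \<and> \<bar>x $ i - x $ j\<bar> \<le> R then x $ j else 0))"
    by (simp add: fun_eq_iff hk_step_def vec_eq_iff hk_neighbors_def influence_graph_def
        sum.If_cases)
  have [measurable]: "(\<lambda>x::real^'a. x $ i) \<in> borel_measurable borel" for i
    by (intro borel_measurable_continuous_onI continuous_intros)
  have vec: "f \<in> borel_measurable borel"
    if "\<And>i. (\<lambda>x. f x $ i) \<in> borel_measurable borel" for f :: "real^'a \<Rightarrow> real^'a"
    using that by (subst borel_measurable_euclidean_space)
      (auto simp: Basis_vec_def inner_axis)
  show ?thesis
    unfolding eq by (rule vec) simp
qed

lemma measurable_hk_state [measurable]:
  "(\<lambda>x0. hk_state E R x0 k) \<in> borel_measurable borel"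
  by (induction k) simp_all

lemma measurable_steady_state [measurable]: "steady_state E R \<in> borel_measurable borel"
  unfolding steady_state_def by (rule borel_measurable_lim_metric) simp

lemma measurable_termination_time [measurable]:
  "(\<lambda>x0. ennreal_of_enat (termination_time E R x0)) \<in> borel_measurable borel"
proof -
  have [measurable]: "termination_time E R \<in> measurable borel (count_space UNIV)"
  proof -
    have "termination_time E R = (\<lambda>x0. INF k. if 1 \<le> k \<and>
        hk_state E R x0 k = steady_state E R x0 then enat k else \<infinity>)"
    proof (rule ext, rule antisym)
      fix x0
      show "termination_time E R x0 \<le> (INF k. if 1 \<le> k \<and>
        hk_state E R x0 k = steady_state E R x0 then enat k else \<infinity>)"
        by (rule INF_greatest) (auto simp: termination_time_def intro!: Inf_lower)
      show "(INF k. if 1 \<le> k \<and> hk_state E R x0 k = steady_state E R x0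
        then enat k else \<infinity>) \<le> termination_time E R x0"
        unfolding termination_time_def
      proof (rule Inf_greatest, clarify)
        fix k :: nat
        assume "1 \<le> k" "hk_state E R x0 k = steady_state E R x0"
        then show "(INF k. if 1 \<le> k \<and> hk_state E R x0 k = steady_state E R x0
          then enat k else \<infinity>) \<le> enat k"
          by (intro INF_lower2[of k]) simp_all
      qed
    qed
    also have "\<dots> \<in> measurable borel (count_space UNIV)"
      by measurable
    finally show ?thesis .
  qed
  show ?thesis by measurable
qed

end

theory Submission
  imports Defs
begin

text \<open>
  The expectation is infinite because \<open>T = \<infinity>\<close> holds on a set of positive probability.

  While all opinions lie in \<open>(-R/2, R/2)\<close>, the confidence bound excludes nobody, so one step of
  the dynamics is the linear map \<open>A = D\<^sup>-\<^sup>1 Adj\<close> that averages over physical neighbours (\<open>D\<close> is the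
  diagonal matrix of degrees), and \<open>A\<close> leaves this open cube invariant. Two properties of \<open>A\<close>
  matter, both read off from the degree-weighted inner product
  \<open>\<langle>x, y\<rangle> = (\<Sum>i. deg i * x i * y i)\<close>.

  First, the energy \<open>\<langle>x, x\<rangle>\<close> drops in each step by the sum over all edges \<open>(i, j)\<close> of
  \<open>(x j - (A x) i)\<^sup>2\<close>. Along an orbit these drops have a bounded sum, so they tend to zero; by
  self-loops and connectivity all differences of opinions vanish in the limit. Since \<open>A\<close> conserves
  the degree-weighted mean, the orbit converges to a consensus.

  Second, \<open>A\<close> is self-adjoint, hence \<open>A\<^sup>k z = 0\<close> with \<open>k \<ge> 1\<close> already forces \<open>A z = 0\<close>. Applied to
  the deviation from consensus, this says that an orbit which ever reaches consensus is at
  consensus after a single step.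

  Now let \<open>i\<close> and \<open>j\<close> be non-adjacent. The linear functional \<open>x \<mapsto> (A x) i - (A x) j\<close> has the
  non-zero coefficient \<open>1 / deg i\<close> at \<open>x i\<close>: agent \<open>i\<close> listens to itself and \<open>j\<close> does not.
  So consensus after one step happens only on a hyperplane. This is a Lebesgue null set, hence null
  for an absolutely continuous distribution, whereas the open cube has positive probability.
\<close>

section \<open>Averaging over neighbours in a graph\<close>

definition neighbor_average :: "('n::finite \<times> 'n) set \<Rightarrow> real ^ 'n \<Rightarrow> real ^ 'n" where
  "neighbor_average E x = (\<chi> i. (\<Sum>j\<in>E `` {i}. x $ j) / real (card (E `` {i})))"

definition degree_inner :: "('n::finite \<times> 'n) set \<Rightarrow> real ^ 'n \<Rightarrow> real ^ 'n \<Rightarrow> real" where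
  "degree_inner E x y = (\<Sum>i\<in>UNIV. real (card (E `` {i})) * x $ i * y $ i)"

lemma neighbors_nonempty:
  assumes "refl E"
  shows "E `` {i} \<noteq> {}"
  using assms by (auto dest: reflD)

lemma degree_pos:
  fixes E :: "('n::finite \<times> 'n) set"
  assumes "refl E"
  shows "0 < card (E `` {i})"
  using neighbors_nonempty[OF assms] by (simp add: card_gt_0_iff)

lemma degree_times_average:
  fixes E :: "('n::finite \<times> 'n) set"
  assumes "refl E"
  shows "real (card (E `` {i})) * neighbor_average E x $ i = (\<Sum>j\<in>E `` {i}. x $ j)"
  using degree_pos[OF assms, of i] by (simp add: neighbor_average_def)

lemma neighbor_average_diff:
  "neighbor_average E (x - y) = neighbor_average E x - neighbor_average E y"
  by (simp add: neighbor_average_def vec_eq_iff sum_subtractf diff_divide_distrib)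

lemma neighbor_average_consensus:
  assumes "refl E"
  shows "neighbor_average E (\<chi> i. c) = (\<chi> i. c)"
  using neighbors_nonempty[OF assms] by (simp add: neighbor_average_def vec_eq_iff)

lemma funpow_neighbor_average_deviation:
  assumes "refl E"
  shows "(neighbor_average E ^^ k) (x - (\<chi> i. c)) = (neighbor_average E ^^ k) x - (\<chi> i. c)"
  by (induction k) (simp_all add: neighbor_average_diff neighbor_average_consensus[OF assms])

lemma sum_edges_swap:
  fixes E :: "('n::finite \<times> 'n) set" and g :: "'n \<Rightarrow> 'n \<Rightarrow> real"
  assumes "sym E"
  shows "(\<Sum>i\<in>UNIV. \<Sum>j\<in>E `` {i}. g i j) = (\<Sum>i\<in>UNIV. \<Sum>j\<in>E `` {i}. g j i)"
proof -
  have *: "E `` {i} = {j \<in> UNIV. (i, j) \<in> E}" "E `` {i} = {j \<in> UNIV. (j, i) \<in> E}" for i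
    using assms by (auto dest: symD)
  have "(\<Sum>i\<in>UNIV. \<Sum>j\<in>E `` {i}. g i j) = (\<Sum>j\<in>UNIV. \<Sum>i\<in>{i \<in> UNIV. (i, j) \<in> E}. g i j)"
    unfolding *(1) by (rule sum.swap_restrict) simp_all
  then show ?thesis
    unfolding *(2) .
qed

section \<open>Self-adjointness\<close>

text \<open>The degree weights cancel the normalisation of the average; what remains is the quadratic
  form of the adjacency matrix, which is symmetric.\<close>

lemma neighbor_average_self_adjoint:
  assumes "sym E" "refl E"
  shows "degree_inner E (neighbor_average E x) y = degree_inner E x (neighbor_average E y)"
proof -
  have "degree_inner E (neighbor_average E x) y = (\<Sum>i\<in>UNIV. \<Sum>j\<in>E `` {i}. x $ j * y $ i)"
    by (simp add: degree_inner_def degree_times_average[OF assms(2)] sum_distrib_right)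
  also have "\<dots> = (\<Sum>i\<in>UNIV. \<Sum>j\<in>E `` {i}. x $ i * y $ j)"
    by (rule sum_edges_swap[OF assms(1)])
  also have "\<dots> = (\<Sum>i\<in>UNIV. x $ i * (real (card (E `` {i})) * neighbor_average E y $ i))"
    by (simp add: degree_times_average[OF assms(2)] sum_distrib_left)
  also have "\<dots> = degree_inner E x (neighbor_average E y)"
    by (simp add: degree_inner_def mult_ac)
  finally show ?thesis .
qed

lemma degree_inner_nonneg: "0 \<le> degree_inner E x x"
  by (simp add: degree_inner_def mult.assoc sum_nonneg)

lemma degree_inner_eq_0D:
  assumes "refl E" "degree_inner E x x = 0"
  shows "x = 0"
proof -
  have "\<forall>i\<in>UNIV. real (card (E `` {i})) * x $ i * x $ i = 0"
    using assms(2) unfolding degree_inner_def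
    by (subst (asm) sum_nonneg_eq_0_iff) (simp_all add: mult.assoc)
  then show ?thesis
    using neighbors_nonempty[OF assms(1)] by (simp add: vec_eq_iff)
qed

text \<open>A self-adjoint map has no nilpotent part: \<open>A (A w) = 0\<close> gives
  \<open>\<langle>A w, A w\<rangle> = \<langle>w, A (A w)\<rangle> = 0\<close>.\<close>

lemma neighbor_average_ker_power:
  assumes "sym E" "refl E" "(neighbor_average E ^^ Suc k) z = 0"
  shows "neighbor_average E z = 0"
  using assms(3)
proof (induction k)
  case 0
  then show ?case by simp
next
  case (Suc k)
  let ?w = "(neighbor_average E ^^ k) z"
  have "degree_inner E (neighbor_average E ?w) (neighbor_average E ?w)
      = degree_inner E ?w (neighbor_average E (neighbor_average E ?w))"
    by (rule neighbor_average_self_adjoint[OF assms(1,2)])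
  also have "\<dots> = 0"
    using Suc.prems by (simp add: degree_inner_def)
  finally have "(neighbor_average E ^^ Suc k) z = 0"
    using degree_inner_eq_0D[OF assms(2)] by simp
  then show ?case by (rule Suc.IH)
qed

section \<open>Convergence to consensus\<close>

text \<open>Symmetry turns \<open>\<langle>x, x\<rangle>\<close> into the sum of \<open>(x j)\<^sup>2\<close> over all edges \<open>(i, j)\<close>. For each fixed \<open>i\<close>
  the decrease is then the usual identity "mean of squares minus square of the mean equals
  variance", multiplied by the degree.\<close>

lemma energy_decrease:
  assumes "sym E" "refl E"
  shows "degree_inner E x x - degree_inner E (neighbor_average E x) (neighbor_average E x)
    = (\<Sum>i\<in>UNIV. \<Sum>j\<in>E `` {i}. (x $ j - neighbor_average E x $ i)\<^sup>2)"
proof -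
  let ?a = "\<lambda>i. neighbor_average E x $ i"
  have energy: "degree_inner E x x = (\<Sum>i\<in>UNIV. \<Sum>j\<in>E `` {i}. (x $ j)\<^sup>2)"
    using sum_edges_swap[OF assms(1), of "\<lambda>i j. (x $ j)\<^sup>2"]
    by (simp add: degree_inner_def power2_eq_square mult.assoc)
  have variance: "(\<Sum>j\<in>E `` {i}. (x $ j - ?a i)\<^sup>2)
      = (\<Sum>j\<in>E `` {i}. (x $ j)\<^sup>2) - real (card (E `` {i})) * ?a i * ?a i" for i
  proof -
    have "(\<Sum>j\<in>E `` {i}. (x $ j - ?a i)\<^sup>2)
        = (\<Sum>j\<in>E `` {i}. (x $ j)\<^sup>2) - 2 * ?a i * (\<Sum>j\<in>E `` {i}. x $ j)
          + real (card (E `` {i})) * (?a i)\<^sup>2"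
      by (simp add: power2_diff sum.distrib sum_subtractf sum_distrib_left mult_ac)
    then show ?thesis
      unfolding degree_times_average[OF assms(2), symmetric]
      by (simp add: power2_eq_square algebra_simps)
  qed
  show ?thesis
    unfolding energy variance by (simp add: sum_subtractf degree_inner_def)
qed

text \<open>The energies decrease and are non-negative, so they converge and consecutive ones come
  arbitrarily close; every term of the variance sum is squeezed to zero with their difference.\<close>

lemma edge_difference_tendsto_0:
  assumes "sym E" "refl E" "(i, j) \<in> E"
  shows "(\<lambda>k. (neighbor_average E ^^ k) x $ j - (neighbor_average E ^^ k) x $ i) \<longlonglongrightarrow> 0"
proof -
  define y where "y k = (neighbor_average E ^^ k) x" for k
  have y_Suc: "y (Suc k) = neighbor_average E (y k)" for k
    by (simp add: y_def)
  define e where "e k = degree_inner E (y k) (y k)" for k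
  have drop: "e k - e (Suc k) = (\<Sum>i\<in>UNIV. \<Sum>j\<in>E `` {i}. (y k $ j - y (Suc k) $ i)\<^sup>2)" for k
    unfolding e_def y_Suc by (rule energy_decrease[OF assms(1,2)])
  have "e (Suc k) \<le> e k" for k
  proof -
    have "0 \<le> e k - e (Suc k)"
      unfolding drop by (intro sum_nonneg) simp
    then show ?thesis by simp
  qed
  then have "decseq e"
    by (rule decseq_SucI)
  moreover have "0 \<le> e k" for k
    unfolding e_def by (rule degree_inner_nonneg)
  ultimately obtain l where "e \<longlonglongrightarrow> l"
    using decseq_convergent[of e 0] by blast
  then have "(\<lambda>k. e k - e (Suc k)) \<longlonglongrightarrow> l - l"
    by (intro tendsto_diff LIMSEQ_Suc)
  then have drop_0: "(\<lambda>k. e k - e (Suc k)) \<longlonglongrightarrow> 0"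
    by simp
  have step: "(\<lambda>k. y k $ j' - y (Suc k) $ i) \<longlonglongrightarrow> 0" if "(i, j') \<in> E" for j'
  proof -
    have "(y k $ j' - y (Suc k) $ i)\<^sup>2 \<le> e k - e (Suc k)" for k
    proof -
      have "(y k $ j' - y (Suc k) $ i)\<^sup>2 \<le> (\<Sum>j\<in>E `` {i}. (y k $ j - y (Suc k) $ i)\<^sup>2)"
        using that by (intro member_le_sum) auto
      also have "\<dots> \<le> e k - e (Suc k)"
        unfolding drop
        by (rule member_le_sum[of i UNIV "\<lambda>i. \<Sum>j\<in>E `` {i}. (y k $ j - y (Suc k) $ i)\<^sup>2"])
          (auto intro: sum_nonneg)
      finally show ?thesis .
    qed
    then have "(\<lambda>k. (y k $ j' - y (Suc k) $ i)\<^sup>2) \<longlonglongrightarrow> 0"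
      by (intro tendsto_sandwich[OF _ _ tendsto_const drop_0]) simp_all
    then show ?thesis
      by simp
  qed
  \<comment> \<open>Both endpoints at time \<open>k\<close> are compared with \<open>i\<close> at time \<open>k + 1\<close>; for \<open>i\<close> itself this uses
    its self-loop.\<close>
  have "(i, i) \<in> E"
    using assms(2) by (auto dest: reflD)
  then have "(\<lambda>k. (y k $ j - y (Suc k) $ i) - (y k $ i - y (Suc k) $ i)) \<longlonglongrightarrow> 0 - 0"
    by (intro tendsto_diff step assms(3))
  then show ?thesis
    by (simp add: y_def)
qed

lemma difference_tendsto_0:
  assumes "sym E" "refl E" "(i, j) \<in> E\<^sup>*"
  shows "(\<lambda>k. (neighbor_average E ^^ k) x $ j - (neighbor_average E ^^ k) x $ i) \<longlonglongrightarrow> 0"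
  using assms(3)
proof (induction rule: rtrancl_induct)
  case base
  then show ?case by simp
next
  case (step j l)
  from tendsto_add[OF step.IH edge_difference_tendsto_0[OF assms(1,2) step.hyps(2), of x]]
  show ?case by simp
qed

lemma degree_sum_invariant:
  assumes "sym E" "refl E"
  shows "(\<Sum>i\<in>UNIV. real (card (E `` {i})) * (neighbor_average E ^^ k) x $ i)
    = (\<Sum>i\<in>UNIV. real (card (E `` {i})) * x $ i)"
proof (induction k)
  case (Suc k)
  let ?y = "(neighbor_average E ^^ k) x"
  \<comment> \<open>The weighted sum of a vector is its inner product with the all-ones vector, which is fixed
    by averaging.\<close>
  have "degree_inner E (neighbor_average E ?y) (\<chi> i. 1) = degree_inner E ?y (\<chi> i. 1)"
    by (simp add: neighbor_average_self_adjoint[OF assms] neighbor_average_consensus[OF assms(2)])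
  then show ?case
    using Suc.IH by (simp add: degree_inner_def)
qed simp

lemma neighbor_average_converges_to_consensus:
  fixes E :: "('n::finite \<times> 'n) set"
  assumes "physical_graph E"
  obtains c where "(\<lambda>k. (neighbor_average E ^^ k) x) \<longlonglongrightarrow> (\<chi> i. c)"
proof
  have E: "sym E" "refl E" and conn: "(i, j) \<in> E\<^sup>*" for i j
    using assms by (auto simp: physical_graph_def)
  define y where "y k = (neighbor_average E ^^ k) x" for k
  define d where "d i = real (card (E `` {i}))" for i
  define W where "W = (\<Sum>i\<in>UNIV. d i)"
  define c where "c = (\<Sum>i\<in>UNIV. d i * x $ i) / W"
  have "0 < W"
    unfolding W_def d_def using degree_pos[OF E(2)] by (intro sum_pos) auto
  have mean: "(\<Sum>i\<in>UNIV. d i * y k $ i) = W * c" for k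
    using degree_sum_invariant[OF E, of k x] \<open>0 < W\<close> by (simp add: c_def d_def y_def)
  have "(\<lambda>k. y k $ i) \<longlonglongrightarrow> c" for i
  proof -
    have "y k $ i = c + (\<Sum>j\<in>UNIV. d j * (y k $ i - y k $ j)) / W" for k
    proof -
      have "(\<Sum>j\<in>UNIV. d j * (y k $ i - y k $ j)) = W * y k $ i - W * c"
        by (simp add: right_diff_distrib sum_subtractf mean W_def sum_distrib_right)
      then show ?thesis
        using \<open>0 < W\<close> by (simp add: field_simps)
    qed
    moreover have "(\<lambda>k. c + (\<Sum>j\<in>UNIV. d j * (y k $ i - y k $ j)) / W)
        \<longlonglongrightarrow> c + (\<Sum>j\<in>UNIV. d j * 0) / W"
      unfolding y_def using \<open>0 < W\<close>
      by (intro tendsto_intros difference_tendsto_0[OF E conn]) auto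
    ultimately show ?thesis by simp
  qed
  then show "(\<lambda>k. (neighbor_average E ^^ k) x) \<longlonglongrightarrow> (\<chi> i. c)"
    by (intro vec_tendstoI) (simp add: y_def)
qed

section \<open>The dynamics near the origin\<close>

lemma hk_step_eq_neighbor_average:
  assumes "\<And>i. \<bar>x $ i\<bar> < R / 2"
  shows "hk_step E R x = neighbor_average E x"
proof -
  have "\<bar>x $ i - x $ j\<bar> \<le> R" for i j
    using assms[of i] assms[of j] by linarith
  then have "hk_neighbors E R x i = E `` {i}" for i
    by (auto simp: hk_neighbors_def influence_graph_def)
  then show ?thesis
    by (simp add: hk_step_def neighbor_average_def vec_eq_iff)
qed

lemma neighbor_average_abs_less:
  assumes "refl E" and "\<And>i. \<bar>x $ i\<bar> < r"
  shows "\<bar>neighbor_average E x $ i\<bar> < r"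
proof -
  have "real (card (E `` {i})) * \<bar>neighbor_average E x $ i\<bar>
      = \<bar>\<Sum>j\<in>E `` {i}. x $ j\<bar>"
    using degree_times_average[OF assms(1), of i x] by (metis abs_mult abs_of_nat)
  also have "\<dots> \<le> (\<Sum>j\<in>E `` {i}. \<bar>x $ j\<bar>)"
    by (rule sum_abs)
  also have "\<dots> < (\<Sum>j\<in>E `` {i}. r)"
    using degree_pos[OF assms(1), of i] by (intro sum_strict_mono assms(2)) auto
  also have "\<dots> = real (card (E `` {i})) * r"
    by simp
  finally show ?thesis
    using degree_pos[OF assms(1), of i] by simp
qed

lemma hk_state_eq_funpow_neighbor_average:
  assumes "refl E" and "\<And>i. \<bar>x $ i\<bar> < R / 2"
  shows "hk_state E R x k = (neighbor_average E ^^ k) x"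
proof -
  have bound: "\<bar>(neighbor_average E ^^ k) x $ i\<bar> < R / 2" for i k
    by (induction k arbitrary: i)
      (simp_all add: assms neighbor_average_abs_less del: less_divide_eq_numeral1)
  show ?thesis
    by (induction k) (simp_all add: hk_step_eq_neighbor_average[OF bound])
qed

text \<open>Terminating means hitting the limiting consensus \<open>c\<close> at some time \<open>k \<ge> 1\<close>, that is,
  \<open>A\<^sup>k (x - c) = 0\<close>. The kernel does not grow with \<open>k\<close>, so \<open>A x = c\<close>.\<close>

lemma termination_imp_consensus_after_one_step:
  assumes "physical_graph E" and "\<And>i. \<bar>x $ i\<bar> < R / 2"
    and "termination_time E R x \<noteq> \<infinity>"
  shows "neighbor_average E x $ i = neighbor_average E x $ j"
proof -
  have E: "sym E" "refl E"
    using assms(1) by (auto simp: physical_graph_def)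
  have state: "hk_state E R x = (\<lambda>k. (neighbor_average E ^^ k) x)"
    using hk_state_eq_funpow_neighbor_average[OF E(2) assms(2)] by auto
  obtain c where "(\<lambda>k. (neighbor_average E ^^ k) x) \<longlonglongrightarrow> (\<chi> i. c)"
    using neighbor_average_converges_to_consensus[OF assms(1)] .
  then have steady: "steady_state E R x = (\<chi> i. c)"
    unfolding steady_state_def state by (rule limI)
  have "{enat k | k. 1 \<le> k \<and> hk_state E R x k = steady_state E R x} \<noteq> {}"
  proof
    assume "{enat k | k. 1 \<le> k \<and> hk_state E R x k = steady_state E R x} = {}"
    then have "termination_time E R x = \<infinity>"
      unfolding termination_time_def by (simp only: Inf_empty top_enat_def)
    with assms(3) show False ..
  qed
  then obtain k where "1 \<le> k" "hk_state E R x k = steady_state E R x"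
    by blast
  moreover from \<open>1 \<le> k\<close> obtain m where "k = Suc m"
    by (cases k) auto
  ultimately have "(neighbor_average E ^^ Suc m) x = (\<chi> i. c)"
    by (simp add: state steady)
  then have "(neighbor_average E ^^ Suc m) (x - (\<chi> i. c)) = 0"
    using funpow_neighbor_average_deviation[OF E(2), of "Suc m" x c] by simp
  then have "neighbor_average E (x - (\<chi> i. c)) = 0"
    by (rule neighbor_average_ker_power[OF E])
  then have "neighbor_average E x = (\<chi> i. c)"
    by (simp add: neighbor_average_diff neighbor_average_consensus[OF E(2)])
  then show ?thesis by simp
qed

section \<open>Consensus after one step is a null event\<close>

text \<open>The two averages are the linear functionals \<open>w i\<close> and \<open>w j\<close>. They differ at coordinate \<open>i\<close>,
  where \<open>w i\<close> is positive by the self-loop and \<open>w j\<close> vanishes, so they agree only on a hyperplane.\<close>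

lemma agreement_of_nonadjacent_null:
  fixes E :: "('n::finite \<times> 'n) set"
  assumes "sym E" "refl E" "(i, j) \<notin> E"
  shows "AE x in lborel. neighbor_average E x $ i \<noteq> neighbor_average E x $ j"
proof -
  define w :: "'n \<Rightarrow> real ^ 'n" where
    "w l = (\<chi> m. if (l, m) \<in> E then 1 / real (card (E `` {l})) else 0)" for l
  have average: "neighbor_average E x $ l = w l \<bullet> x" for l x
  proof -
    have "w l \<bullet> x = (\<Sum>m\<in>UNIV. if m \<in> E `` {l} then x $ m / real (card (E `` {l})) else 0)"
      unfolding inner_vec_def w_def by (intro sum.cong) auto
    also have "\<dots> = neighbor_average E x $ l"
      by (simp add: sum.If_cases neighbor_average_def sum_divide_distrib Image_def)
    finally show ?thesis by simp
  qed
  have "w i $ i \<noteq> w j $ i"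
    using assms degree_pos[OF assms(2), of i] by (auto simp: w_def dest: symD reflD)
  then have "w i - w j \<noteq> 0"
    by auto
  then have "negligible {x. (w i - w j) \<bullet> x = 0}"
    by (intro negligible_hyperplane) simp
  moreover have "closed {x. (w i - w j) \<bullet> x = 0}"
    by (rule closed_hyperplane)
  ultimately have "{x. (w i - w j) \<bullet> x = 0} \<in> null_sets lborel"
    by (simp add: negligible_iff_null_sets null_sets_completion_iff borel_closed)
  then show ?thesis
    by (rule AE_I') (auto simp: average inner_diff_left)
qed

theorem proposition1:
  fixes E :: "('n::finite \<times> 'n) set"
    and R :: real
    and M :: "'a measure"
    and X :: "'a \<Rightarrow> real ^ 'n"
    and f :: "real ^ 'n \<Rightarrow> ennreal"
  assumes "R > 0"
    and "physical_graph E"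
    and "prob_space M"
    and "distributed M lborel X f"
    and "\<And>V. open V \<Longrightarrow> V \<noteq> {} \<Longrightarrow> emeasure (distr M borel X) V > 0"
    and "\<not> is_complete E"
  shows "(\<integral>\<^sup>+ \<omega>. ennreal_of_enat (termination_time E R (X \<omega>)) \<partial>M) = \<infinity>"
proof (rule ccontr)
  assume finite: "(\<integral>\<^sup>+ \<omega>. ennreal_of_enat (termination_time E R (X \<omega>)) \<partial>M) \<noteq> \<infinity>"
  have E: "sym E" "refl E"
    using assms(2) by (auto simp: physical_graph_def)
  obtain i j where "(i, j) \<notin> E"
    using assms(6) by (auto simp: is_complete_def)
  have X_lborel: "X \<in> measurable M lborel"
    using assms(4) by (rule distributed_measurable)
  then have X [measurable]: "X \<in> measurable M borel"
    by simp
  have f: "f \<in> borel_measurable lborel"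
    using assms(4) by (rule distributed_borel_measurable)
  have "AE x in density lborel f. neighbor_average E x $ i \<noteq> neighbor_average E x $ j"
    using agreement_of_nonadjacent_null[OF E \<open>(i, j) \<notin> E\<close>]
    by (subst AE_density[OF f]) auto
  then have "AE x in distr M lborel X. neighbor_average E x $ i \<noteq> neighbor_average E x $ j"
    unfolding distributed_distr_eq_density[OF assms(4)] .
  then have no_agreement:
    "AE \<omega> in M. neighbor_average E (X \<omega>) $ i \<noteq> neighbor_average E (X \<omega>) $ j"
    by (rule AE_distrD[OF X_lborel])
  have "AE \<omega> in M. ennreal_of_enat (termination_time E R (X \<omega>)) \<noteq> \<infinity>"
    by (rule nn_integral_PInf_AE[OF _ finite]) measurable
  then have terminates: "AE \<omega> in M. termination_time E R (X \<omega>) \<noteq> \<infinity>"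
    by (rule eventually_mono) (metis ennreal_of_enat_infty infinity_ennreal_def)
  define U :: "(real ^ 'n) set" where "U = {x. \<forall>i. \<bar>x $ i\<bar> < R / 2}"
  have "open U"
    unfolding U_def Collect_all_eq
    by (intro open_INT finite_class.finite_UNIV ballI open_Collect_less continuous_intros)
  moreover have "0 \<in> U"
    using assms(1) by (simp add: U_def)
  ultimately have "emeasure (distr M borel X) U > 0"
    by (intro assms(5)) auto
  moreover have "emeasure (distr M borel X) U = emeasure M {\<omega> \<in> space M. X \<omega> \<in> U}"
    using \<open>open U\<close> by (subst emeasure_distr) (auto simp: vimage_def Int_def conj_commute)
  moreover have "AE \<omega> in M. X \<omega> \<notin> U"
    using terminates no_agreement
  proof eventually_elim
    case (elim \<omega>)
    then show ?case
      using termination_imp_consensus_after_one_step[OF assms(2), of "X \<omega>" R i j]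
      by (auto simp: U_def)
  qed
  then have "emeasure M {\<omega> \<in> space M. X \<omega> \<in> U} = 0"
    by (rule emeasure_eq_0_AE)
  ultimately show False
    by simp
qed

end
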